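(* Let $x^+\in G(x,v)$ be a stochastic difference inclusion on $\mathcal X\subseteq\mathbb R^n$ with random inputs in $\mathcal V\subseteq\mathbb R^m$, satisfying the standing assumptions (A1)–(A4) and the i.i.d. assumption listed in the context. Let $B:\mathcal X\to\mathbb R_{\ge0}$ be upper semicontinuous, $\Delta>0$, $K_\Delta=\{x\in\mathcal X: B(x)\le\Delta\}$ and $K_\Delta^C=\mathcal X\setminus K_\Delta$. For any $k\in\mathbb N$ and $x\in\mathcal X$, the probability of reaching $K_\Delta^C$ from $x$ in exactly the $(k+1)$th step is bounded above by $\frac1\Delta\mathbb E[\lambda_{k+1}^B(x,v_0,\dots,v_k)]$, i.e. $$\mathbb P\big(\lambda_{k+1}^B(x,v_0,\dots,v_k)>\Delta\big)\le\frac1\Delta\,\mathbb E\big[\lambda_{k+1}^B(x,v_0,\dots,v_k)\big].$$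
   Context: Setting. $G:\mathcal X\times\mathcal V\rightrightarrows\mathbb R^n$ is a set-valued map with $G(x,v)\subseteq\mathcal X$. Assumptions on $G$: (A1) for each $v\in\mathcal V$, $x\mapsto G(x,v)$ is upper semicontinuous, meaning that for every $x$ and $\epsilon>0$ there is a neighborhood $U(x)$ with $G(y,v)\subseteq G(x,v)+\epsilon\mathbb B$ for all $y\in U(x)\cap\mathcal X$ ($\mathbb B$ the open unit ball); (A2) $G$ is locally bounded: each point of $\mathcal X\times\mathcal V$ has a neighborhood on which all elements of the values of $G$ are bounded in norm by a common constant; (A3) each $G(x,v)$ is nonempty, closed and convex; (A4) $v\mapsto\operatorname{graph}(G(\cdot,v))=\{(x,y)\in\mathcal X\times\mathcal X: y\in G(x,v)\}$ is a measurable set-valued map (preimages $\{v:\operatorname{graph}(G(\cdot,v))\cap O\ne\emptyset\}$ of open sets $O$ are measurable). I.i.d. assumption: $(v_i)_{i\ge0}$ are i.i.d. random vectors on a probability space $(\Omega,\mathcal F,\mathbb P)$ with values in $\mathcal V$ and common distribution $\mu$ on the Borel sets of $\mathcal V$. Functions $\lambda_k^B:\mathcal X\times\mathcal V^k\to\mathbb R_{\ge0}$: $\lambda_0^B(x)=B(x)$ and $\lambda_{k+1}^B(x,v_0,\dots,v_k)=\sup_{x_1\in G(x,v_0)}\lambda_k^B(x_1,v_1,\dots,v_k)$. The event of reaching $K_\Delta^C$ from $x$ at step $k+1$ (some trajectory $x_0=x$, $x_{i+1}\in G(x_i,v_i)$ has $x_{k+1}\in K_\Delta^C$) is the event $\lambda_{k+1}^B(x,v_0,\dots,v_k)>\Delta$.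 *)

theory Defs
  imports "HOL-Probability.Probability"
begin

text \<open>
  A set-valued map on a set \<open>X\<close> (or \<open>X \<times> V\<close>) is represented by a total set-valued
  function; all notions below only refer to its values on that set.
\<close>

definition usc_setmap_on ::
  "(real^'n) set \<Rightarrow> (real^'n \<Rightarrow> (real^'n) set) \<Rightarrow> bool" where
  "usc_setmap_on X F \<longleftrightarrow>
    (\<forall>x\<in>X. \<forall>\<epsilon>>0. \<exists>U. open U \<and> x \<in> U \<and>
      (\<forall>y\<in>U \<inter> X. F y \<subseteq> {a + b | a b. a \<in> F x \<and> b \<in> ball 0 \<epsilon>}))"

definition locally_bounded_on ::
  "(real^'n) set \<Rightarrow> (real^'m) set \<Rightarrow> (real^'n \<Rightarrow> real^'m \<Rightarrow> (real^'n) set) \<Rightarrow> bool" where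
  "locally_bounded_on X V G \<longleftrightarrow>
    (\<forall>x\<in>X. \<forall>v\<in>V. \<exists>U r. open U \<and> (x, v) \<in> U \<and>
      (\<forall>(y, w) \<in> U \<inter> (X \<times> V). \<forall>z\<in>G y w. norm z \<le> r))"

definition graph_on ::
  "(real^'n) set \<Rightarrow> (real^'n \<Rightarrow> (real^'n) set) \<Rightarrow> ((real^'n) \<times> (real^'n)) set" where
  "graph_on X F = {(x, y). x \<in> X \<and> y \<in> X \<and> y \<in> F x}"

definition measurable_setmap_on ::
  "('m::topological_space) set \<Rightarrow> ('m \<Rightarrow> ('b::topological_space) set) \<Rightarrow> bool" where
  "measurable_setmap_on V F \<longleftrightarrow>
    (\<forall>Q. open Q \<longrightarrow> {v\<in>V. F v \<inter> Q \<noteq> {}} \<in> sets (restrict_space borel V))"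

definition stochastic_inclusion ::
  "(real^'n) set \<Rightarrow> (real^'m) set \<Rightarrow> (real^'n \<Rightarrow> real^'m \<Rightarrow> (real^'n) set) \<Rightarrow> bool" where
  "stochastic_inclusion X V G \<longleftrightarrow>
    (\<forall>x\<in>X. \<forall>v\<in>V. G x v \<subseteq> X) \<and>
    (\<forall>v\<in>V. usc_setmap_on X (\<lambda>x. G x v)) \<and>
    locally_bounded_on X V G \<and>
    (\<forall>x\<in>X. \<forall>v\<in>V. G x v \<noteq> {} \<and> closed (G x v) \<and> convex (G x v)) \<and>
    measurable_setmap_on V (\<lambda>v. graph_on X (\<lambda>x. G x v))"

text \<open>The target space \<open>restrict_space borel V\<close> forces every \<open>v i\<close> to take values in \<open>V\<close>.\<close>

definition iid_inputs ::
  "'w measure \<Rightarrow> (real^'m) set \<Rightarrow> (real^'m) measure \<Rightarrow> (nat \<Rightarrow> 'w \<Rightarrow> real^'m) \<Rightarrow> bool" where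
  "iid_inputs M V \<mu> v \<longleftrightarrow>
    prob_space M \<and>
    prob_space.indep_vars M (\<lambda>_. restrict_space borel V) v UNIV \<and>
    (\<forall>i. distr M (restrict_space borel V) (v i) = \<mu>)"

definition usc_fun_on :: "(real^'n) set \<Rightarrow> (real^'n \<Rightarrow> real) \<Rightarrow> bool" where
  "usc_fun_on X B \<longleftrightarrow> (\<forall>x\<in>X. \<forall>c>B x. \<forall>\<^sub>F y in at x within X. B y < c)"

text \<open>
  \<open>lam G B vs x\<close> is \<open>\<lambda>\<^sub>j\<^sup>B(x, v\<^sub>0, \<dots>, v\<^sub>j\<^sub>-\<^sub>1)\<close> for \<open>vs = [v\<^sub>0, \<dots>, v\<^sub>j\<^sub>-\<^sub>1]\<close>. For a
  stochastic inclusion and an upper semicontinuous \<open>B\<close>, each \<open>G x v\<close> is nonempty and compact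
  and \<open>lam G B vs\<close> is upper semicontinuous on \<open>X\<close>, so that the real-valued supremum
  is over a nonempty set that is bounded above.
\<close>

primrec lam ::
  "(real^'n \<Rightarrow> real^'m \<Rightarrow> (real^'n) set) \<Rightarrow> (real^'n \<Rightarrow> real) \<Rightarrow>
   (real^'m) list \<Rightarrow> real^'n \<Rightarrow> real" where
  "lam G B [] x = B x"
| "lam G B (v # vs) x = (SUP y\<in>G x v. lam G B vs y)"

definition reach_event ::
  "'w measure \<Rightarrow> (real^'n \<Rightarrow> real^'m \<Rightarrow> (real^'n) set) \<Rightarrow> (nat \<Rightarrow> 'w \<Rightarrow> real^'m) \<Rightarrow>
   real^'n \<Rightarrow> nat \<Rightarrow> (real^'n) set \<Rightarrow> 'w set" where
  "reach_event M G v x j S =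
    {\<omega> \<in> space M. \<exists>\<xi> :: nat \<Rightarrow> real^'n. \<xi> 0 = x \<and>
      (\<forall>i<j. \<xi> (Suc i) \<in> G (\<xi> i) (v i \<omega>)) \<and> \<xi> j \<in> S}"

end

theory Submission
  imports Defs
begin

text \<open>
  The bound is Markov's inequality; the work lies in the measurability of \<open>L\<close>, for arbitrary
  (possibly non-measurable) \<open>X\<close> and \<open>V\<close>. Since the values of \<open>G\<close> are compact and the iterated suprema
  are upper semicontinuous, all suprema are attained, so \<open>\<lambda>\<^sub>j\<^sup>B \<ge> c\<close> holds iff some
  trajectory ends in \<open>{B \<ge> c}\<close>. By compactness this is equivalent to the existence, for every
  \<open>\<epsilon> > 0\<close>, of an \<open>\<epsilon>\<close>-chain whose intermediate nodes lie in a fixed countable dense set and each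
  of whose links only asks that \<open>graph (G(\<cdot>, v\<^sub>i))\<close> meets a product of two \<open>\<epsilon>\<close>-balls. By (A4) the
  latter is a countable combination of measurable conditions on the individual \<open>v\<^sub>i\<close>.
\<close>

section \<open>Compactness and sequential limits\<close>

lemma compact_attains_sup_closed_superlevel:
  fixes f :: "'a::topological_space \<Rightarrow> 'b::linorder"
  assumes "compact S" "S \<noteq> {}" and closed: "\<And>c. closed {y\<in>S. c \<le> f y}"
  obtains y where "y \<in> S" "\<And>z. z \<in> S \<Longrightarrow> f z \<le> f y"
proof -
  \<comment> \<open>Finite intersection property: among finitely many points of \<open>S\<close>,
    one maximizing \<open>f\<close> lies in all of their superlevel sets. A point common to all
    superlevel sets is a maximizer.\<close>
  have "S \<inter> \<Inter>((\<lambda>z. {y\<in>S. f z \<le> f y}) ` S) \<noteq> {}"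
  proof (rule compact_imp_fip_image[OF \<open>compact S\<close>])
    fix I assume I: "finite I" "I \<subseteq> S"
    show "S \<inter> (\<Inter>z\<in>I. {y\<in>S. f z \<le> f y}) \<noteq> {}"
    proof (cases "I = {}")
      case True
      then show ?thesis using assms(2) by simp
    next
      case False
      then have "Max (f ` I) \<in> f ` I" using I by simp
      then obtain m where "m \<in> I" "f m = Max (f ` I)" by fastforce
      then have "m \<in> S \<inter> (\<Inter>z\<in>I. {y\<in>S. f z \<le> f y})" using I by auto
      then show ?thesis by blast
    qed
  qed (rule closed)
  then show thesis using that by blast
qed

text \<open>Semicontinuity at \<open>x\<close> only forces the distance from \<open>b j\<close> to
  \<open>F x\<close> to tend to 0. Nearest points of the compact set \<open>F x\<close> therefore
  replace the \<open>b j\<close>, and a convergent subsequence of them carries \<open>b\<close>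
  along.\<close>

lemma usc_setmap_on_convergent_subseq:
  assumes usc: "usc_setmap_on X F" and comp: "compact (F x)" and x: "x \<in> X"
    and a: "\<And>j. a j \<in> X" "a \<longlonglongrightarrow> x" and b: "\<And>j. b j \<in> F (a j)"
  obtains y r where "y \<in> F x" "strict_mono (r :: nat \<Rightarrow> nat)" "(b \<circ> r) \<longlonglongrightarrow> y"
proof -
  have near: "\<forall>\<^sub>F j in sequentially. \<exists>z\<in>F x. dist (b j) z < e" if e: "e > 0" for e
  proof -
    obtain U where U: "open U" "x \<in> U"
      "\<forall>y\<in>U \<inter> X. F y \<subseteq> {a + b | a b. a \<in> F x \<and> b \<in> ball 0 e}"
      using usc[unfolded usc_setmap_on_def, rule_format, OF x e] by blast
    have "\<forall>\<^sub>F j in sequentially. a j \<in> U" using a(2) U(1,2) by (rule topological_tendstoD)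
    then show ?thesis
    proof eventually_elim
      case (elim j)
      then have "b j \<in> {a + b | a b. a \<in> F x \<and> b \<in> ball 0 e}" using U(3) a(1) b by blast
      then obtain s t where "b j = s + t" "s \<in> F x" "norm t < e" by auto
      then show ?case by (auto simp: dist_norm intro!: bexI[of _ s])
    qed
  qed
  have ne: "F x \<noteq> {}"
    using eventually_happens'[OF sequentially_bot near[OF zero_less_one]] by blast
  have "\<exists>z\<in>F x. dist (b j) z = infdist (b j) (F x)" for j
    using infdist_attains_inf[OF compact_imp_closed[OF comp] ne] by metis
  then obtain z where z: "\<And>j. z j \<in> F x" "\<And>j. dist (b j) (z j) = infdist (b j) (F x)" by metis
  have zb: "(\<lambda>j. dist (b j) (z j)) \<longlonglongrightarrow> 0"
  proof (rule order_tendstoI)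
    fix e :: real assume "0 < e"
    from near[OF this] show "\<forall>\<^sub>F j in sequentially. dist (b j) (z j) < e"
      by eventually_elim (auto simp: z(2) intro: le_less_trans[OF infdist_le])
  qed (auto intro!: always_eventually less_le_trans[OF _ zero_le_dist])
  obtain y r where y: "y \<in> F x" "strict_mono (r :: nat \<Rightarrow> nat)" "(z \<circ> r) \<longlonglongrightarrow> y"
    using seq_compactE[OF compact_imp_seq_compact[OF comp], of z] z(1) by blast
  have "(\<lambda>j. dist (b (r j)) (z (r j))) \<longlonglongrightarrow> 0"
    using LIMSEQ_subseq_LIMSEQ[OF zb y(2)] by (simp add: comp_def)
  then have "(\<lambda>j. b (r j) - z (r j)) \<longlonglongrightarrow> 0"
    by (simp add: dist_norm tendsto_norm_zero_iff)
  from tendsto_add[OF this y(3)[unfolded comp_def]] have "(b \<circ> r) \<longlonglongrightarrow> y"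
    by (simp add: comp_def)
  with y that show thesis by blast
qed

lemma tendsto_close_sequence:
  fixes q :: "nat \<Rightarrow> 'a::real_normed_vector"
  assumes "q \<longlonglongrightarrow> x" "e \<longlonglongrightarrow> 0" "\<And>j. dist (q j) (z j) < e j"
  shows "z \<longlonglongrightarrow> x"
proof (rule Lim_transform2[OF assms(1)])
  show "(\<lambda>j. q j - z j) \<longlonglongrightarrow> 0"
    by (rule Lim_null_comparison[OF _ assms(2)])
      (use assms(3) in \<open>auto simp: dist_norm less_imp_le\<close>)
qed

lemma usc_fun_on_ge_limit:
  assumes "usc_fun_on X B" "x \<in> X" "\<And>j. z j \<in> X" "\<And>j. c \<le> B (z j)" "z \<longlonglongrightarrow> x"
  shows "c \<le> B x"
proof (rule ccontr)
  assume "\<not> c \<le> B x"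
  \<comment> \<open>The filter \<open>at x within X\<close> omits \<open>x\<close>, so terms with
    \<open>z j = x\<close> need a separate argument: for them \<open>c \<le> B (z j)\<close>
    contradicts the assumption on \<open>B x\<close> directly.\<close>
  then have "\<forall>\<^sub>F y in nhds x. y \<noteq> x \<longrightarrow> y \<in> X \<longrightarrow> B y < c"
    using assms(1,2) unfolding usc_fun_on_def by (simp add: eventually_at_filter)
  then have "\<forall>\<^sub>F j in sequentially. z j \<noteq> x \<longrightarrow> z j \<in> X \<longrightarrow> B (z j) < c"
    using assms(5) unfolding filterlim_iff by blast
  then have "\<forall>\<^sub>F j in sequentially. False"
    by eventually_elim (use assms(3,4) \<open>\<not> c \<le> B x\<close> in \<open>metis not_le\<close>)
  then show False by simp
qed

text \<open>A link tests whether the graph meets an open box, the form of condition that (A4)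
  controls. Nodes come from \<open>D\<close>, so that the quantifier can be countable, and may lie
  outside \<open>X\<close>, which can have empty interior. The base case involves no input, hence no
  measurability of \<open>X\<close> or \<open>B\<close>.\<close>

primrec pseudo_reach ::
  "(real^'n) set \<Rightarrow> (real^'n \<Rightarrow> real^'m \<Rightarrow> (real^'n) set) \<Rightarrow> (real^'n \<Rightarrow> real) \<Rightarrow> (real^'n) set \<Rightarrow>
   real \<Rightarrow> real \<Rightarrow> (real^'m) list \<Rightarrow> real^'n \<Rightarrow> bool" where
  "pseudo_reach X G B D c e [] q \<longleftrightarrow> (\<exists>z\<in>X. c \<le> B z \<and> dist q z < e)"
| "pseudo_reach X G B D c e (v # vs) q \<longleftrightarrow>
    (\<exists>p\<in>D. graph_on X (\<lambda>x. G x v) \<inter> (ball q e \<times> ball p e) \<noteq> {} \<and>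
      pseudo_reach X G B D c e vs p)"

section \<open>Chain characterization of the superlevel sets of \<open>lam\<close>\<close>

locale usc_stochastic_inclusion =
  fixes X :: "(real^'n) set" and V :: "(real^'m) set"
    and G :: "real^'n \<Rightarrow> real^'m \<Rightarrow> (real^'n) set" and B :: "real^'n \<Rightarrow> real"
  assumes incl: "stochastic_inclusion X V G" and usc_B: "usc_fun_on X B"
begin

lemma value_subset: "x \<in> X \<Longrightarrow> v \<in> V \<Longrightarrow> G x v \<subseteq> X"
  and value_nonempty: "x \<in> X \<Longrightarrow> v \<in> V \<Longrightarrow> G x v \<noteq> {}"
  and usc_G: "v \<in> V \<Longrightarrow> usc_setmap_on X (\<lambda>x. G x v)"
  using incl unfolding stochastic_inclusion_def by blast+

lemma value_compact:
  assumes "x \<in> X" "v \<in> V"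
  shows "compact (G x v)"
proof -
  have "locally_bounded_on X V G" using incl unfolding stochastic_inclusion_def by blast
  then obtain U r where "(x, v) \<in> U" "\<forall>(y, w) \<in> U \<inter> (X \<times> V). \<forall>z\<in>G y w. norm z \<le> r"
    using assms unfolding locally_bounded_on_def by meson
  then have "\<forall>z\<in>G x v. norm z \<le> r" using assms by blast
  then have "bounded (G x v)" unfolding bounded_iff by blast
  moreover have "closed (G x v)" using incl assms unfolding stochastic_inclusion_def by blast
  ultimately show ?thesis by (simp add: compact_eq_bounded_closed)
qed

text \<open>The first half lets the start \<open>q j\<close> vary with the tolerance, because after
  one link the nodes of the chains merely converge. The halves are bundled because attainment of the
  next supremum, needed in the induction, uses both.\<close>

definition pseudo_reach_characterizes :: "(real^'n) set \<Rightarrow> (real^'m) list \<Rightarrow> bool" where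
  "pseudo_reach_characterizes D vs \<longleftrightarrow>
    (\<forall>c x e q. x \<in> X \<longrightarrow> e \<longlonglongrightarrow> 0 \<longrightarrow> q \<longlonglongrightarrow> x \<longrightarrow>
      (\<forall>j. pseudo_reach X G B D c (e j) vs (q j)) \<longrightarrow> c \<le> lam G B vs x) \<and>
    (\<forall>c x e q. x \<in> X \<longrightarrow> c \<le> lam G B vs x \<longrightarrow> dist q x < e \<longrightarrow>
      pseudo_reach X G B D c e vs q)"

lemma pseudo_reach_characterizes_limit:
  assumes "pseudo_reach_characterizes D vs" "x \<in> X" "e \<longlonglongrightarrow> 0" "q \<longlonglongrightarrow> x"
    "\<And>j. pseudo_reach X G B D c (e j) vs (q j)"
  shows "c \<le> lam G B vs x"
  by (rule assms(1)[unfolded pseudo_reach_characterizes_def, THEN conjunct1, rule_format,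
        OF assms(2-5)])

lemma pseudo_reach_characterizesD:
  assumes "pseudo_reach_characterizes D vs" "x \<in> X" "c \<le> lam G B vs x" "dist q x < e"
  shows "pseudo_reach X G B D c e vs q"
  by (rule assms(1)[unfolded pseudo_reach_characterizes_def, THEN conjunct2, rule_format,
        OF assms(2-4)])

lemma pseudo_reach_characterizes_attained:
  assumes "pseudo_reach_characterizes D vs" "x \<in> X" "v \<in> V"
  obtains y where "y \<in> G x v" "lam G B (v # vs) x = lam G B vs y"
    "\<And>z. z \<in> G x v \<Longrightarrow> lam G B vs z \<le> lam G B vs y"
proof -
  \<comment> \<open>Each \<open>z n\<close> starts a chain of tolerance \<open>1 / (n + 1)\<close>
    at itself by the second half; the first half then passes to the limit \<open>y\<close>.\<close>
  have closed: "closed {y \<in> G x v. c \<le> lam G B vs y}" for c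
    unfolding closed_sequential_limits
  proof (intro allI impI, elim conjE)
    fix z y assume z: "\<forall>n. z n \<in> {y \<in> G x v. c \<le> lam G B vs y}" "z \<longlonglongrightarrow> y"
    have y: "y \<in> G x v"
      by (rule closed_sequentially[OF compact_imp_closed[OF value_compact[OF assms(2,3)]] _ z(2)])
        (use z(1) in blast)
    have "pseudo_reach X G B D c (inverse (real (Suc n))) vs (z n)" for n
      by (rule pseudo_reach_characterizesD[OF assms(1), where x = "z n"]) (use z(1) value_subset[OF assms(2,3)] in auto)
    moreover have "y \<in> X" using y value_subset assms by blast
    ultimately have "c \<le> lam G B vs y"
      using pseudo_reach_characterizes_limit[OF assms(1) _ LIMSEQ_inverse_real_of_nat z(2)] by blast
    with y show "y \<in> {y \<in> G x v. c \<le> lam G B vs y}" by blast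
  qed
  obtain y where y: "y \<in> G x v" "\<And>z. z \<in> G x v \<Longrightarrow> lam G B vs z \<le> lam G B vs y"
    by (rule compact_attains_sup_closed_superlevel
        [OF value_compact[OF assms(2,3)] value_nonempty[OF assms(2,3)] closed]) (rule that)
  moreover have "lam G B (v # vs) x = lam G B vs y"
    using y by (auto intro!: cSup_eq_maximum)
  ultimately show thesis using that by blast
qed

lemma pseudo_reach_characterizes:
  assumes dense: "\<And>U :: (real^'n) set. open U \<Longrightarrow> U \<noteq> {} \<Longrightarrow> \<exists>d\<in>D. d \<in> U"
    and "set vs \<subseteq> V"
  shows "pseudo_reach_characterizes D vs"
  using assms(2)
proof (induction vs)
  case Nil
  show ?case unfolding pseudo_reach_characterizes_def
  proof (rule conjI; intro allI impI)
    fix c x e q assume h: "x \<in> X" "e \<longlonglongrightarrow> 0" "q \<longlonglongrightarrow> x"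
      "\<forall>j. pseudo_reach X G B D c (e j) [] (q j)"
    then obtain z where z: "\<And>j. z j \<in> X" "\<And>j. c \<le> B (z j)" "\<And>j. dist (q j) (z j) < e j"
      by (auto simp: Bex_def) metis
    have "z \<longlonglongrightarrow> x" by (rule tendsto_close_sequence[OF h(3,2) z(3)])
    then show "c \<le> lam G B [] x" using usc_fun_on_ge_limit[OF usc_B h(1) z(1,2)] by simp
  qed auto
next
  case (Cons v vs)
  then have IH: "pseudo_reach_characterizes D vs" and v: "v \<in> V" by auto
  show ?case unfolding pseudo_reach_characterizes_def
  proof (rule conjI; intro allI impI)
    fix c x e q assume h: "x \<in> X" "e \<longlonglongrightarrow> 0" "q \<longlonglongrightarrow> x"
      "\<forall>j. pseudo_reach X G B D c (e j) (v # vs) (q j)"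
    \<comment> \<open>The nodes \<open>q j\<close>, \<open>p j\<close> only approximate a true graph
      point \<open>(a j, b j)\<close>. Since \<open>a\<close> tends to \<open>x\<close>,
      semicontinuity yields a limit \<open>y\<close> of a subsequence of \<open>b\<close>, and the
      nodes \<open>p\<close> follow it, so the induction hypothesis applies at
      \<open>y\<close>.\<close>
    have "\<exists>p a b. a \<in> X \<and> b \<in> G a v \<and> dist (q j) a < e j \<and> dist p b < e j \<and>
      pseudo_reach X G B D c (e j) vs p" for j
      using h(4)[rule_format, of j] by (auto simp: graph_on_def)
    then obtain p a b where ch: "\<And>j. a j \<in> X" "\<And>j. b j \<in> G (a j) v"
      "\<And>j. dist (q j) (a j) < e j" "\<And>j. dist (p j) (b j) < e j"
      "\<And>j. pseudo_reach X G B D c (e j) vs (p j)" by metis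
    have a: "a \<longlonglongrightarrow> x" by (rule tendsto_close_sequence[OF h(3,2) ch(3)])
    obtain y r where y: "y \<in> G x v" "strict_mono (r :: nat \<Rightarrow> nat)" "(b \<circ> r) \<longlonglongrightarrow> y"
      by (rule usc_setmap_on_convergent_subseq
          [OF usc_G[OF v] value_compact[OF h(1) v] h(1) ch(1) a ch(2)])
    have er: "(e \<circ> r) \<longlonglongrightarrow> 0" by (rule LIMSEQ_subseq_LIMSEQ[OF h(2) y(2)])
    have "(p \<circ> r) \<longlonglongrightarrow> y"
      by (rule tendsto_close_sequence[OF y(3) er]) (use ch(4) in \<open>simp add: dist_commute\<close>)
    moreover have "y \<in> X" using y(1) value_subset h(1) v by blast
    moreover have "\<forall>j. pseudo_reach X G B D c ((e \<circ> r) j) vs ((p \<circ> r) j)" using ch(5) by simp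
    ultimately have "c \<le> lam G B vs y" using pseudo_reach_characterizes_limit[OF IH _ er] by blast
    then show "c \<le> lam G B (v # vs) x"
      using pseudo_reach_characterizes_attained[OF IH h(1) v] y(1) by (metis order_trans)
  next
    fix c x e q assume h: "x \<in> X" "c \<le> lam G B (v # vs) x" "dist q x < e"
    obtain y where y: "y \<in> G x v" "lam G B (v # vs) x = lam G B vs y"
      using pseudo_reach_characterizes_attained[OF IH h(1) v] by metis
    have "0 < e" using h(3) zero_le_dist[of q x] by linarith
    \<comment> \<open>The chain shadows an exact maximizing trajectory: each node is chosen within
      \<open>e\<close> of the exact point \<open>y\<close>, not of the previous node's image, so
      errors do not accumulate.\<close>
    then obtain p where p: "p \<in> D" "p \<in> ball y e" using dense[of "ball y e"] by auto
    have "y \<in> X" using y(1) value_subset h(1) v by blast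
    moreover from this have "pseudo_reach X G B D c e vs p"
      by (rule pseudo_reach_characterizesD[OF IH]) (use h(2) y(2) p(2) in \<open>simp_all add: dist_commute\<close>)
    moreover have "(x, y) \<in> ball q e \<times> ball p e" using h(3) p(2) by (simp add: dist_commute)
    moreover have "(x, y) \<in> graph_on X (\<lambda>x. G x v)"
      using \<open>y \<in> X\<close> y(1) h(1) by (simp add: graph_on_def)
    ultimately show "pseudo_reach X G B D c e (v # vs) q"
      using p(1) unfolding pseudo_reach.simps by blast
  qed
qed

section \<open>Attained suprema and trajectories\<close>

lemma lam_Cons_attained:
  assumes "set vs \<subseteq> V" "x \<in> X" "v \<in> V"
  obtains y where "y \<in> G x v" "lam G B (v # vs) x = lam G B vs y"
    "\<And>z. z \<in> G x v \<Longrightarrow> lam G B vs z \<le> lam G B vs y"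
proof -
  \<comment> \<open>The conclusion does not mention \<open>D\<close>, and countability matters only
    for measurability, so the whole space can serve as the dense set.\<close>
  have "pseudo_reach_characterizes UNIV vs"
    by (rule pseudo_reach_characterizes) (use assms(1) in auto)
  then show thesis
    by (rule pseudo_reach_characterizes_attained[OF _ assms(2,3)]) (rule that)
qed

text \<open>Choosing a maximizer at every step produces the trajectory; conversely, each step of a
  trajectory is dominated by the maximum over the same value of \<open>G\<close>.\<close>

lemma lam_ge_iff_trajectory:
  assumes "set vs \<subseteq> V" "x \<in> X"
  shows "c \<le> lam G B vs x \<longleftrightarrow>
    (\<exists>\<xi>. \<xi> 0 = x \<and> (\<forall>i<length vs. \<xi> (Suc i) \<in> G (\<xi> i) (vs ! i)) \<and>
      \<xi> (length vs) \<in> X \<and> c \<le> B (\<xi> (length vs)))"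
  using assms
proof (induction vs arbitrary: x)
  case Nil
  then show ?case by auto
next
  case (Cons v vs)
  obtain y where y: "y \<in> G x v" "lam G B (v # vs) x = lam G B vs y"
    "\<And>z. z \<in> G x v \<Longrightarrow> lam G B vs z \<le> lam G B vs y"
    using lam_Cons_attained[of vs x v] Cons.prems by auto
  have sub: "G x v \<subseteq> X" using value_subset Cons.prems by simp
  have IH: "z \<in> X \<Longrightarrow> c \<le> lam G B vs z \<longleftrightarrow>
    (\<exists>\<xi>. \<xi> 0 = z \<and> (\<forall>i<length vs. \<xi> (Suc i) \<in> G (\<xi> i) (vs ! i)) \<and>
      \<xi> (length vs) \<in> X \<and> c \<le> B (\<xi> (length vs)))" for z
    using Cons by simp
  show ?case
  proof
    assume "c \<le> lam G B (v # vs) x"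
    then have "c \<le> lam G B vs y" using y(2) by simp
    then obtain \<xi> where \<xi>: "\<xi> 0 = y" "\<forall>i<length vs. \<xi> (Suc i) \<in> G (\<xi> i) (vs ! i)"
      "\<xi> (length vs) \<in> X" "c \<le> B (\<xi> (length vs))"
      using IH[of y] sub y(1) by blast
    show "\<exists>\<xi>. \<xi> 0 = x \<and> (\<forall>i<length (v # vs). \<xi> (Suc i) \<in> G (\<xi> i) ((v # vs) ! i)) \<and>
      \<xi> (length (v # vs)) \<in> X \<and> c \<le> B (\<xi> (length (v # vs)))"
      by (rule exI[of _ "case_nat x \<xi>"]) (use \<xi> y(1) in \<open>auto split: nat.split simp: less_Suc_eq_0_disj\<close>)
  next
    assume "\<exists>\<xi>. \<xi> 0 = x \<and> (\<forall>i<length (v # vs). \<xi> (Suc i) \<in> G (\<xi> i) ((v # vs) ! i)) \<and>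
      \<xi> (length (v # vs)) \<in> X \<and> c \<le> B (\<xi> (length (v # vs)))"
    then obtain \<xi> where \<xi>: "\<xi> 0 = x" "\<forall>i<Suc (length vs). \<xi> (Suc i) \<in> G (\<xi> i) ((v # vs) ! i)"
      "\<xi> (Suc (length vs)) \<in> X" "c \<le> B (\<xi> (Suc (length vs)))"
      by auto
    then have "\<xi> 1 \<in> G x v" by auto
    moreover have "\<forall>i<length vs. \<xi> (Suc (Suc i)) \<in> G (\<xi> (Suc i)) (vs ! i)" using \<xi>(2) by auto
    ultimately have "c \<le> lam G B vs (\<xi> 1)"
      using IH[of "\<xi> 1"] sub \<xi>(3,4) by (auto intro!: exI[of _ "\<lambda>i. \<xi> (Suc i)"])
    then show "c \<le> lam G B (v # vs) x" using y(2) y(3)[OF \<open>\<xi> 1 \<in> G x v\<close>] by linarith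
  qed
qed

section \<open>Measurability and the reaching event\<close>

lemma measurable_pseudo_reach:
  assumes "countable D" and v: "\<And>i. v i \<in> measurable M (restrict_space borel V)"
  shows "{\<omega> \<in> space M. pseudo_reach X G B D c e (map (\<lambda>i. v i \<omega>) is) q} \<in> sets M"
proof (induction "is" arbitrary: q)
  case Nil
  then show ?case by simp
next
  case (Cons i "is")
  have "{\<omega> \<in> space M. graph_on X (\<lambda>x. G x (v i \<omega>)) \<inter> (ball q e \<times> ball p e) \<noteq> {}} \<in> sets M" for p
  proof -
    have "{w\<in>V. graph_on X (\<lambda>x. G x w) \<inter> (ball q e \<times> ball p e) \<noteq> {}} \<in> sets (restrict_space borel V)"
      using incl unfolding stochastic_inclusion_def measurable_setmap_on_def
      by (simp add: open_Times)
    from measurable_sets[OF v[of i] this] have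
      "v i -` {w\<in>V. graph_on X (\<lambda>x. G x w) \<inter> (ball q e \<times> ball p e) \<noteq> {}} \<inter> space M \<in> sets M" .
    moreover have "v i \<omega> \<in> V" if "\<omega> \<in> space M" for \<omega>
      using measurable_space[OF v that] by (simp add: space_restrict_space)
    then have "v i -` {w\<in>V. graph_on X (\<lambda>x. G x w) \<inter> (ball q e \<times> ball p e) \<noteq> {}} \<inter> space M =
      {\<omega> \<in> space M. graph_on X (\<lambda>x. G x (v i \<omega>)) \<inter> (ball q e \<times> ball p e) \<noteq> {}}" by auto
    ultimately show ?thesis by simp
  qed
  \<comment> \<open>For fixed \<open>p\<close> the two conjuncts concern the first input and the
    remaining ones separately, and the union over \<open>p\<close> is countable.\<close>
  then show ?case unfolding list.map pseudo_reach.simps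
    by (intro sets.sets_Collect_countable_Ex'[OF _ assms(1)] sets.sets_Collect_conj Cons.IH)
qed

lemma borel_measurable_lam:
  assumes v: "\<And>i. v i \<in> measurable M (restrict_space borel V)" and x: "x \<in> X"
  shows "(\<lambda>\<omega>. lam G B (map (\<lambda>i. v i \<omega>) is) x) \<in> borel_measurable M"
  unfolding borel_measurable_iff_ge
proof
  fix c
  obtain D :: "(real^'n) set" where D: "countable D" "\<And>U. open U \<Longrightarrow> U \<noteq> {} \<Longrightarrow> \<exists>d\<in>D. d \<in> U"
    using countable_dense_exists by auto
  \<comment> \<open>Chains of every tolerance \<open>1 / (n + 1)\<close> from the constant start
    \<open>x\<close> decide the level, turning the superlevel set into a countable
    intersection.\<close>
  have "c \<le> lam G B (map (\<lambda>i. v i \<omega>) is) x \<longleftrightarrow>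
    (\<forall>n. pseudo_reach X G B D c (inverse (real (Suc n))) (map (\<lambda>i. v i \<omega>) is) x)"
    if "\<omega> \<in> space M" for \<omega>
  proof -
    have "set (map (\<lambda>i. v i \<omega>) is) \<subseteq> V"
      using measurable_space[OF v that] by (auto simp: space_restrict_space)
    with D(2) have "pseudo_reach_characterizes D (map (\<lambda>i. v i \<omega>) is)"
      by (intro pseudo_reach_characterizes) auto
    from pseudo_reach_characterizes_limit[OF this x LIMSEQ_inverse_real_of_nat tendsto_const]
      pseudo_reach_characterizesD[OF this x, of c x] show ?thesis by auto
  qed
  then have "{\<omega> \<in> space M. c \<le> lam G B (map (\<lambda>i. v i \<omega>) is) x} =
    {\<omega> \<in> space M. \<forall>n. pseudo_reach X G B D c (inverse (real (Suc n))) (map (\<lambda>i. v i \<omega>) is) x}"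
    by blast
  also have "\<dots> \<in> sets M"
    by (intro sets.sets_Collect_countable_All measurable_pseudo_reach D(1) v)
  finally show "{\<omega> \<in> space M. c \<le> lam G B (map (\<lambda>i. v i \<omega>) is) x} \<in> sets M" .
qed

text \<open>Trajectories are characterized for non-strict levels, while the event is strict. The
  level \<open>B (\<xi> j)\<close> handles one direction; the value of \<open>lam\<close> itself,
  reached by some trajectory, handles the other.\<close>

lemma reach_event_superlevel:
  assumes v: "\<And>i. v i \<in> measurable M (restrict_space borel V)" and x: "x \<in> X"
  shows "reach_event M G v x j (X - {y\<in>X. B y \<le> \<Delta>}) =
    {\<omega> \<in> space M. \<Delta> < lam G B (map (\<lambda>i. v i \<omega>) [0..<j]) x}"
proof -
  have "(\<exists>\<xi>. \<xi> 0 = x \<and> (\<forall>i<j. \<xi> (Suc i) \<in> G (\<xi> i) (v i \<omega>)) \<and> \<xi> j \<in> X - {y\<in>X. B y \<le> \<Delta>})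
    \<longleftrightarrow> \<Delta> < lam G B (map (\<lambda>i. v i \<omega>) [0..<j]) x" if "\<omega> \<in> space M" for \<omega>
  proof -
    have V: "set (map (\<lambda>i. v i \<omega>) [0..<j]) \<subseteq> V"
      using measurable_space[OF v that] by (auto simp: space_restrict_space)
    have iff: "c \<le> lam G B (map (\<lambda>i. v i \<omega>) [0..<j]) x \<longleftrightarrow>
      (\<exists>\<xi>. \<xi> 0 = x \<and> (\<forall>i<j. \<xi> (Suc i) \<in> G (\<xi> i) (v i \<omega>)) \<and> \<xi> j \<in> X \<and> c \<le> B (\<xi> j))" for c
      using lam_ge_iff_trajectory[OF V x, of c] by simp
    show ?thesis
    proof
      assume "\<exists>\<xi>. \<xi> 0 = x \<and> (\<forall>i<j. \<xi> (Suc i) \<in> G (\<xi> i) (v i \<omega>)) \<and> \<xi> j \<in> X - {y\<in>X. B y \<le> \<Delta>}"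
      then obtain \<xi> where \<xi>: "\<xi> 0 = x" "\<forall>i<j. \<xi> (Suc i) \<in> G (\<xi> i) (v i \<omega>)" "\<xi> j \<in> X"
        "\<Delta> < B (\<xi> j)"
        by auto
      have "B (\<xi> j) \<le> lam G B (map (\<lambda>i. v i \<omega>) [0..<j]) x"
        unfolding iff by (rule exI[of _ \<xi>]) (use \<xi> in simp)
      with \<xi>(4) show "\<Delta> < lam G B (map (\<lambda>i. v i \<omega>) [0..<j]) x" by linarith
    next
      assume "\<Delta> < lam G B (map (\<lambda>i. v i \<omega>) [0..<j]) x"
      then show "\<exists>\<xi>. \<xi> 0 = x \<and> (\<forall>i<j. \<xi> (Suc i) \<in> G (\<xi> i) (v i \<omega>)) \<and> \<xi> j \<in> X - {y\<in>X. B y \<le> \<Delta>}"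
        using iff[of "lam G B (map (\<lambda>i. v i \<omega>) [0..<j]) x"] by fastforce
    qed
  qed
  then show ?thesis unfolding reach_event_def by blast
qed

end

section \<open>The probability bound\<close>

theorem lemma15:
  fixes X :: "(real^'n) set" and V :: "(real^'m) set"
    and G :: "real^'n \<Rightarrow> real^'m \<Rightarrow> (real^'n) set"
    and M :: "'w measure" and \<mu> :: "(real^'m) measure"
    and v :: "nat \<Rightarrow> 'w \<Rightarrow> real^'m"
    and B :: "real^'n \<Rightarrow> real" and \<Delta> :: real
    and k :: nat and x :: "real^'n"
    and K :: "(real^'n) set" and L :: "'w \<Rightarrow> real"
  assumes "stochastic_inclusion X V G"
    and "iid_inputs M V \<mu> v"
    and "\<forall>y\<in>X. 0 \<le> B y"
    and "usc_fun_on X B"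
    and "0 < \<Delta>"
    and "x \<in> X"
    and "K = {y\<in>X. B y \<le> \<Delta>}"
    and "L = (\<lambda>\<omega>. lam G B (map (\<lambda>i. v i \<omega>) [0..<Suc k]) x)"
  shows "L \<in> borel_measurable M \<and>
    reach_event M G v x (Suc k) (X - K) = {\<omega> \<in> space M. L \<omega> > \<Delta>} \<and>
    emeasure M {\<omega> \<in> space M. L \<omega> > \<Delta>} \<le> ennreal (1 / \<Delta>) * (\<integral>\<^sup>+ \<omega>. ennreal (L \<omega>) \<partial>M)"
proof -
  interpret usc_stochastic_inclusion X V G B by unfold_locales fact+
  interpret prob_space M using assms(2) unfolding iid_inputs_def by blast
  have v: "v i \<in> measurable M (restrict_space borel V)" for i
    using assms(2) unfolding iid_inputs_def by (auto simp: indep_vars_def2)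
  have L: "L \<in> borel_measurable M" unfolding assms(8) by (rule borel_measurable_lam[OF v assms(6)])
  have "reach_event M G v x (Suc k) (X - K) = {\<omega> \<in> space M. L \<omega> > \<Delta>}"
    unfolding assms(7,8) by (rule reach_event_superlevel[OF v assms(6)])
  moreover have "emeasure M {\<omega> \<in> space M. L \<omega> > \<Delta>} \<le> ennreal (1 / \<Delta>) * (\<integral>\<^sup>+ \<omega>. ennreal (L \<omega>) \<partial>M)"
  proof -
    \<comment> \<open>Rescaling by \<open>1 / \<Delta>\<close> turns the threshold into the 1 of
      \<open>nn_integral_Markov_inequality\<close>. On the event \<open>L \<omega>\<close> is
      positive, so \<open>ennreal\<close> truncates nothing there.\<close>
    have "1 \<le> ennreal (1 / \<Delta>) * ennreal (L \<omega>)" if "L \<omega> > \<Delta>" for \<omega>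
      using that \<open>0 < \<Delta>\<close> by (simp flip: ennreal_mult'' add: field_simps)
    then have "emeasure M {\<omega> \<in> space M. L \<omega> > \<Delta>} \<le>
      emeasure M {\<omega> \<in> space M. 1 \<le> ennreal (1 / \<Delta>) * ennreal (L \<omega>)}"
      using L by (intro emeasure_mono) auto
    also have "\<dots> \<le> ennreal (1 / \<Delta>) * (\<integral>\<^sup>+ \<omega>. ennreal (L \<omega>) * indicator (space M) \<omega> \<partial>M)"
      using L by (intro nn_integral_Markov_inequality) auto
    also have "(\<integral>\<^sup>+ \<omega>. ennreal (L \<omega>) * indicator (space M) \<omega> \<partial>M) = (\<integral>\<^sup>+ \<omega>. ennreal (L \<omega>) \<partial>M)"
      by (intro nn_integral_cong) simp
    finally show ?thesis .
  qed
  ultimately show ?thesis using L by blast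
qed

end
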